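(* Let $(T,\varepsilon,\delta)$ be a comonad on a category $\mathcal{C}$ and let $L$ be a localization on $\mathcal{C}$ with unit $l$. Let $U$ be the forgetful functor from the category $\mathcal{C}_T$ of $T$-coalgebras to $\mathcal{C}$. Then the following statements are equivalent: (a) $T$ preserves $L$-local objects. (b) For every $T$-coalgebra $(X,a)$ there is a $T$-coalgebra structure $\tilde a\colon LX\to TLX$ on $LX$ such that $l_X\colon (X,a)\to (LX,\tilde a)$ is a morphism of $T$-coalgebras, and if $g\colon (X,a)\to (Y,b)$ is any morphism of $T$-coalgebras then so is $Lg\colon (LX,\tilde a)\to (LY,\tilde b)$. (c) There is a localization $L_T$ on $\mathcal{C}_T$ with unit $l_T$ such that $LU=UL_T$ and $lU=Ul_T$. (d) There is a localization $L_T$ on $\mathcal{C}_T$ together with a natural isomorphism $LU\cong UL_T$. If these statements hold, then the $T$-coalgebra structures $\tilde a\colon LX\to TLX$ given in part (b) are unique, and the localization $L_T$ in (c) is also unique. Moreover, $U$ preserves and reflects local objects and equivalences.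
   Context: A localization on a category $\mathcal{C}$ is a functor $L=JK\colon\mathcal{C}\to\mathcal{C}$ where $J\colon\mathcal{S}\hookrightarrow\mathcal{C}$ is the inclusion of a full reflective subcategory and $K$ is left adjoint to $J$; its unit $l\colon\mathrm{Id}\to L$ is the unit of this adjunction, and $(L,l)$ is an idempotent monad. An object $X$ is $L$-local if $l_X$ is an isomorphism. A morphism $g$ is an $L$-equivalence if $Lg$ is an isomorphism. A comonad $(T,\varepsilon,\delta)$ on $\mathcal{C}$ has counit $\varepsilon\colon T\to\mathrm{Id}$ and comultiplication $\delta\colon T\to TT$. A $T$-coalgebra is a pair $(X,a)$ with $a\colon X\to TX$ such that $Ta\circ a=\delta_X\circ a$ and $\varepsilon_X\circ a=\mathrm{id}_X$; the category of $T$-coalgebras is $\mathcal{C}_T$ and $U(X,a)=X$. Given localizations $L_1$ on $\mathcal{C}_1$ and $L_2$ on $\mathcal{C}_2$, a functor $F\colon\mathcal{C}_1\to\mathcal{C}_2$ preserves (resp. reflects) local objects if $FX$ is $L_2$-local whenever $X$ is $L_1$-local (resp. $X$ is $L_1$-local whenever $FX$ is $L_2$-local), and it preserves (resp. reflects) equivalences if $Ff$ is an $L_2$-equivalence whenever $f$ is an $L_1$-equivalence (resp. $f$ is an $L_1$-equivalence whenever $Ff$ is an $L_2$-equivalence). For $U$ these notions refer to $L_T$ on $\mathcal{C}_T$ and $L$ on $\mathcal{C}$. *)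

theory Defs
  imports Main
begin

section \<open>Categories, functors and natural transformations\<close>

record ('o, 'm) cat =
  Obj :: "'o set"
  Arr :: "'m set"
  Dom :: "'m \<Rightarrow> 'o"
  Cod :: "'m \<Rightarrow> 'o"
  Idn :: "'o \<Rightarrow> 'm"
  Cmp :: "'m \<Rightarrow> 'm \<Rightarrow> 'm" (infixr "\<cdot>\<index>" 70)

definition hom :: "('o, 'm) cat \<Rightarrow> 'o \<Rightarrow> 'o \<Rightarrow> 'm set" where
  "hom C x y = {f \<in> Arr C. Dom C f = x \<and> Cod C f = y}"

locale category =
  fixes C :: "('o, 'm) cat" (structure)
  assumes dom_obj: "f \<in> Arr C \<Longrightarrow> Dom C f \<in> Obj C"
    and cod_obj: "f \<in> Arr C \<Longrightarrow> Cod C f \<in> Obj C"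
    and idn_hom: "x \<in> Obj C \<Longrightarrow> Idn C x \<in> hom C x x"
    and cmp_hom: "\<lbrakk>f \<in> hom C x y; g \<in> hom C y z\<rbrakk> \<Longrightarrow> g \<cdot> f \<in> hom C x z"
    and idn_left: "f \<in> hom C x y \<Longrightarrow> Idn C y \<cdot> f = f"
    and idn_right: "f \<in> hom C x y \<Longrightarrow> f \<cdot> Idn C x = f"
    and cmp_assoc: "\<lbrakk>f \<in> hom C w x; g \<in> hom C x y; h \<in> hom C y z\<rbrakk>
      \<Longrightarrow> (h \<cdot> g) \<cdot> f = h \<cdot> (g \<cdot> f)"

definition is_iso :: "('o, 'm) cat \<Rightarrow> 'm \<Rightarrow> bool" where
  "is_iso C f \<longleftrightarrow> f \<in> Arr C \<and>
     (\<exists>g \<in> hom C (Cod C f) (Dom C f).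
        g \<cdot>\<^bsub>C\<^esub> f = Idn C (Dom C f) \<and> f \<cdot>\<^bsub>C\<^esub> g = Idn C (Cod C f))"

record ('o, 'm, 'p, 'n) fctr =
  omap :: "'o \<Rightarrow> 'p"
  amap :: "'m \<Rightarrow> 'n"

locale cat_functor = dom: category C + cod: category D
  for C :: "('o, 'm) cat" and D :: "('p, 'n) cat" +
  fixes F :: "('o, 'm, 'p, 'n) fctr"
  assumes omap_obj: "x \<in> Obj C \<Longrightarrow> omap F x \<in> Obj D"
    and amap_hom: "f \<in> hom C x y \<Longrightarrow> amap F f \<in> hom D (omap F x) (omap F y)"
    and amap_idn: "x \<in> Obj C \<Longrightarrow> amap F (Idn C x) = Idn D (omap F x)"
    and amap_cmp: "\<lbrakk>f \<in> hom C x y; g \<in> hom C y z\<rbrakk>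
      \<Longrightarrow> amap F (g \<cdot>\<^bsub>C\<^esub> f) = amap F g \<cdot>\<^bsub>D\<^esub> amap F f"

definition id_fctr :: "('o, 'm, 'o, 'm) fctr" where
  "id_fctr = \<lparr>omap = (\<lambda>x. x), amap = (\<lambda>f. f)\<rparr>"

definition comp_fctr ::
  "('p, 'n, 'q, 'k) fctr \<Rightarrow> ('o, 'm, 'p, 'n) fctr \<Rightarrow> ('o, 'm, 'q, 'k) fctr"
  (infixr "\<circ>\<^sub>F" 75) where
  "G \<circ>\<^sub>F F = \<lparr>omap = (\<lambda>x. omap G (omap F x)), amap = (\<lambda>f. amap G (amap F f))\<rparr>"

text \<open>Functors are total HOL functions, whose values outside the source category are
  irrelevant; equality of functors is therefore agreement on its objects and arrows.\<close>

definition fctr_eq ::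
  "('o, 'm) cat \<Rightarrow> ('o, 'm, 'p, 'n) fctr \<Rightarrow> ('o, 'm, 'p, 'n) fctr \<Rightarrow> bool" where
  "fctr_eq C F G \<longleftrightarrow> (\<forall>x \<in> Obj C. omap F x = omap G x) \<and> (\<forall>f \<in> Arr C. amap F f = amap G f)"

locale nat_trans = source: cat_functor C D F + target: cat_functor C D G
  for C :: "('o, 'm) cat" and D :: "('p, 'n) cat" and F G +
  fixes \<tau> :: "'o \<Rightarrow> 'n"
  assumes component: "x \<in> Obj C \<Longrightarrow> \<tau> x \<in> hom D (omap F x) (omap G x)"
    and naturality: "f \<in> hom C x y \<Longrightarrow> amap G f \<cdot>\<^bsub>D\<^esub> \<tau> x = \<tau> y \<cdot>\<^bsub>D\<^esub> amap F f"

locale nat_iso = nat_trans +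
  assumes component_iso: "x \<in> Obj C \<Longrightarrow> is_iso D (\<tau> x)"

text \<open>\<open>F\<close> is left adjoint to \<open>G\<close>, with unit \<open>\<eta>\<close> and counit \<open>\<epsilon>\<close>.\<close>

locale adjunction =
  left: cat_functor C D F + right: cat_functor D C G +
  unit: nat_trans C C id_fctr "G \<circ>\<^sub>F F" \<eta> + counit: nat_trans D D "F \<circ>\<^sub>F G" id_fctr \<epsilon>
  for C :: "('o, 'm) cat" and D :: "('p, 'n) cat" and F G \<eta> \<epsilon> +
  assumes triangle_left: "x \<in> Obj C \<Longrightarrow> \<epsilon> (omap F x) \<cdot>\<^bsub>D\<^esub> amap F (\<eta> x) = Idn D (omap F x)"
    and triangle_right: "y \<in> Obj D \<Longrightarrow> amap G (\<epsilon> y) \<cdot>\<^bsub>C\<^esub> \<eta> (omap G y) = Idn C (omap G y)"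


section \<open>Localizations\<close>

definition full_subcat :: "('o, 'm) cat \<Rightarrow> 'o set \<Rightarrow> ('o, 'm) cat" where
  "full_subcat C S = C\<lparr>Obj := S, Arr := {f \<in> Arr C. Dom C f \<in> S \<and> Cod C f \<in> S}\<rparr>"

text \<open>\<open>L\<close> is a localization with unit \<open>l\<close>. The inclusion \<open>J\<close> of a full subcategory acts as the
  identity on the underlying types, so it is \<^const>\<open>id_fctr\<close>.\<close>

definition localization ::
  "('o, 'm) cat \<Rightarrow> ('o, 'm, 'o, 'm) fctr \<Rightarrow> ('o \<Rightarrow> 'm) \<Rightarrow> bool" where
  "localization C L l \<longleftrightarrow>
     (\<exists>S K \<epsilon>. let J = id_fctr in
        S \<subseteq> Obj C \<and> adjunction C (full_subcat C S) K J l \<epsilon> \<and> fctr_eq C L (J \<circ>\<^sub>F K))"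

definition local_obj :: "('o, 'm) cat \<Rightarrow> ('o \<Rightarrow> 'm) \<Rightarrow> 'o \<Rightarrow> bool" where
  "local_obj C l x \<longleftrightarrow> x \<in> Obj C \<and> is_iso C (l x)"

definition local_equiv :: "('o, 'm) cat \<Rightarrow> ('o, 'm, 'o, 'm) fctr \<Rightarrow> 'm \<Rightarrow> bool" where
  "local_equiv C L g \<longleftrightarrow> g \<in> Arr C \<and> is_iso C (amap L g)"

text \<open>Being local depends only on the unit of a localization and being an equivalence only on
  its functor, so only these occur as arguments below.\<close>

definition preserves_local_objs ::
  "('o, 'm) cat \<Rightarrow> ('o \<Rightarrow> 'm) \<Rightarrow> ('p, 'n) cat \<Rightarrow> ('p \<Rightarrow> 'n) \<Rightarrow> ('o, 'm, 'p, 'n) fctr \<Rightarrow> bool" where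
  "preserves_local_objs C l D k F \<longleftrightarrow>
     (\<forall>x \<in> Obj C. local_obj C l x \<longrightarrow> local_obj D k (omap F x))"

definition reflects_local_objs ::
  "('o, 'm) cat \<Rightarrow> ('o \<Rightarrow> 'm) \<Rightarrow> ('p, 'n) cat \<Rightarrow> ('p \<Rightarrow> 'n) \<Rightarrow> ('o, 'm, 'p, 'n) fctr \<Rightarrow> bool" where
  "reflects_local_objs C l D k F \<longleftrightarrow>
     (\<forall>x \<in> Obj C. local_obj D k (omap F x) \<longrightarrow> local_obj C l x)"

definition preserves_equivs ::
  "('o, 'm) cat \<Rightarrow> ('o, 'm, 'o, 'm) fctr \<Rightarrow> ('p, 'n) cat \<Rightarrow> ('p, 'n, 'p, 'n) fctr
     \<Rightarrow> ('o, 'm, 'p, 'n) fctr \<Rightarrow> bool" where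
  "preserves_equivs C L D M F \<longleftrightarrow>
     (\<forall>f \<in> Arr C. local_equiv C L f \<longrightarrow> local_equiv D M (amap F f))"

definition reflects_equivs ::
  "('o, 'm) cat \<Rightarrow> ('o, 'm, 'o, 'm) fctr \<Rightarrow> ('p, 'n) cat \<Rightarrow> ('p, 'n, 'p, 'n) fctr
     \<Rightarrow> ('o, 'm, 'p, 'n) fctr \<Rightarrow> bool" where
  "reflects_equivs C L D M F \<longleftrightarrow>
     (\<forall>f \<in> Arr C. local_equiv D M (amap F f) \<longrightarrow> local_equiv C L f)"


section \<open>Comonads and coalgebras\<close>

locale comonad =
  counit: nat_trans C C T id_fctr \<epsilon> + comult: nat_trans C C T "T \<circ>\<^sub>F T" \<delta>
  for C :: "('o, 'm) cat" and T \<epsilon> \<delta> +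
  assumes coassoc: "x \<in> Obj C \<Longrightarrow>
      amap T (\<delta> x) \<cdot>\<^bsub>C\<^esub> \<delta> x = \<delta> (omap T x) \<cdot>\<^bsub>C\<^esub> \<delta> x"
    and counit_left: "x \<in> Obj C \<Longrightarrow> \<epsilon> (omap T x) \<cdot>\<^bsub>C\<^esub> \<delta> x = Idn C (omap T x)"
    and counit_right: "x \<in> Obj C \<Longrightarrow> amap T (\<epsilon> x) \<cdot>\<^bsub>C\<^esub> \<delta> x = Idn C (omap T x)"

definition coalgebra ::
  "('o, 'm) cat \<Rightarrow> ('o, 'm, 'o, 'm) fctr \<Rightarrow> ('o \<Rightarrow> 'm) \<Rightarrow> ('o \<Rightarrow> 'm) \<Rightarrow> 'o \<times> 'm \<Rightarrow> bool" where
  "coalgebra C T \<epsilon> \<delta> = (\<lambda>(x, a).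
     x \<in> Obj C \<and> a \<in> hom C x (omap T x) \<and>
     amap T a \<cdot>\<^bsub>C\<^esub> a = \<delta> x \<cdot>\<^bsub>C\<^esub> a \<and> \<epsilon> x \<cdot>\<^bsub>C\<^esub> a = Idn C x)"

definition coalg_hom ::
  "('o, 'm) cat \<Rightarrow> ('o, 'm, 'o, 'm) fctr \<Rightarrow> 'o \<times> 'm \<Rightarrow> 'o \<times> 'm \<Rightarrow> 'm \<Rightarrow> bool" where
  "coalg_hom C T = (\<lambda>(x, a) (y, b) g.
     g \<in> hom C x y \<and> amap T g \<cdot>\<^bsub>C\<^esub> a = b \<cdot>\<^bsub>C\<^esub> g)"

text \<open>An arrow of the category of coalgebras is a triple of its source, its underlying arrow
  and its target, because one underlying arrow may be a morphism for several pairs of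
  coalgebra structures.\<close>

definition coalg_cat ::
  "('o, 'm) cat \<Rightarrow> ('o, 'm, 'o, 'm) fctr \<Rightarrow> ('o \<Rightarrow> 'm) \<Rightarrow> ('o \<Rightarrow> 'm)
     \<Rightarrow> ('o \<times> 'm, ('o \<times> 'm) \<times> 'm \<times> ('o \<times> 'm)) cat" where
  "coalg_cat C T \<epsilon> \<delta> =
     \<lparr>Obj = {A. coalgebra C T \<epsilon> \<delta> A},
      Arr = {(A, g, B). coalgebra C T \<epsilon> \<delta> A \<and> coalgebra C T \<epsilon> \<delta> B \<and> coalg_hom C T A B g},
      Dom = (\<lambda>(A, g, B). A),
      Cod = (\<lambda>(A, g, B). B),
      Idn = (\<lambda>A. (A, Idn C (fst A), A)),
      Cmp = (\<lambda>(B, h, D) (A, g, B'). (A, h \<cdot>\<^bsub>C\<^esub> g, D))\<rparr>"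

definition forget :: "('o \<times> 'm, ('o \<times> 'm) \<times> 'm \<times> ('o \<times> 'm), 'o, 'm) fctr" where
  "forget = \<lparr>omap = fst, amap = (\<lambda>(A, g, B). g)\<rparr>"

text \<open>The localization \<open>LT\<close> with unit \<open>lT\<close> on coalgebras lies strictly over \<open>L\<close>: writing \<open>U\<close> for
  \<^const>\<open>forget\<close>, \<open>L U = U LT\<close> and \<open>l U = U lT\<close>.\<close>

definition lifts_to_coalgs ::
  "('o, 'm) cat \<Rightarrow> ('o, 'm, 'o, 'm) fctr \<Rightarrow> ('o \<Rightarrow> 'm) \<Rightarrow> ('o \<Rightarrow> 'm)
     \<Rightarrow> ('o, 'm, 'o, 'm) fctr \<Rightarrow> ('o \<Rightarrow> 'm)
     \<Rightarrow> ('o \<times> 'm, ('o \<times> 'm) \<times> 'm \<times> ('o \<times> 'm), 'o \<times> 'm, ('o \<times> 'm) \<times> 'm \<times> ('o \<times> 'm)) fctr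
     \<Rightarrow> ('o \<times> 'm \<Rightarrow> ('o \<times> 'm) \<times> 'm \<times> ('o \<times> 'm)) \<Rightarrow> bool" where
  "lifts_to_coalgs C T \<epsilon> \<delta> L l LT lT \<longleftrightarrow>
     localization (coalg_cat C T \<epsilon> \<delta>) LT lT \<and>
     fctr_eq (coalg_cat C T \<epsilon> \<delta>) (L \<circ>\<^sub>F forget) (forget \<circ>\<^sub>F LT) \<and>
     (\<forall>A \<in> Obj (coalg_cat C T \<epsilon> \<delta>). l (omap forget A) = amap forget (lT A))"

end

theory Submission
  imports Defs
begin

text \<open>A localization is the same thing as an idempotent monad \<open>(L, l)\<close>, and maps into local objects
  extend uniquely along \<open>l\<close>. If \<open>T\<close> preserves local objects, then \<open>T l\<^sub>X \<cdot> a\<close> therefore extends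
  uniquely to a map \<open>L X \<rightarrow> T L X\<close>, and all required identities hold because they hold after
  composition with \<open>l\<^sub>X\<close>; since \<open>U\<close> reflects isomorphisms, the resulting lift of \<open>(L, l)\<close> is again
  idempotent. Conversely, suppose \<open>L U \<cong> U L\<^sub>T\<close>, let \<open>X\<close> be local and let \<open>u\<close> be the unit of \<open>L\<^sub>T\<close> at the
  cofree coalgebra \<open>(T X, \<delta>\<^sub>X)\<close>. Then \<open>u\<close> is an \<open>L\<close>-equivalence into a local object \<open>Y\<close>, so the
  counit \<open>\<epsilon>\<^sub>X\<close> extends along \<open>u\<close> to some \<open>e : Y \<rightarrow> X\<close>. Composing \<open>T e\<close> with the structure map of
  \<open>Y\<close> gives a retraction of \<open>u\<close>, and a retract of a local object is local.\<close>

section \<open>Isomorphisms, subcategories and functors\<close>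

lemma homD:
  assumes "f \<in> hom C x y"
  shows "f \<in> Arr C" "Dom C f = x" "Cod C f = y"
  using assms by (simp_all add: hom_def)

lemma is_isoI:
  assumes "f \<in> hom C x y" "g \<in> hom C y x" "g \<cdot>\<^bsub>C\<^esub> f = Idn C x" "f \<cdot>\<^bsub>C\<^esub> g = Idn C y"
  shows "is_iso C f"
  using assms by (auto simp: is_iso_def hom_def)

lemma is_isoE:
  assumes "is_iso C f" "f \<in> hom C x y"
  obtains g where "g \<in> hom C y x" "g \<cdot>\<^bsub>C\<^esub> f = Idn C x" "f \<cdot>\<^bsub>C\<^esub> g = Idn C y"
  using assms by (auto simp: is_iso_def hom_def)

lemma arr_hom: "f \<in> Arr C \<Longrightarrow> f \<in> hom C (Dom C f) (Cod C f)"
  by (simp add: hom_def)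

lemma hom_full_subcat: "hom (full_subcat C S) x y = {f \<in> hom C x y. x \<in> S \<and> y \<in> S}"
  by (auto simp: full_subcat_def hom_def)

context category
begin

lemma hom_objs:
  assumes "f \<in> hom C x y"
  shows "x \<in> Obj C" "y \<in> Obj C"
  using assms dom_obj cod_obj by (auto simp: hom_def)

lemma is_iso_idn:
  assumes "x \<in> Obj C"
  shows "is_iso C (Idn C x)"
  using idn_hom[OF assms] by (intro is_isoI[where g = "Idn C x"]) (auto intro: idn_left)

lemma is_iso_cmp:
  assumes f: "f \<in> hom C x y" "is_iso C f" and g: "g \<in> hom C y z" "is_iso C g"
  shows "is_iso C (g \<cdot> f)"
proof -
  obtain f' where f': "f' \<in> hom C y x" "f' \<cdot> f = Idn C x" "f \<cdot> f' = Idn C y"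
    using f by (auto elim: is_isoE)
  obtain g' where g': "g' \<in> hom C z y" "g' \<cdot> g = Idn C y" "g \<cdot> g' = Idn C z"
    using g by (auto elim: is_isoE)
  have "(f' \<cdot> g') \<cdot> (g \<cdot> f) = f' \<cdot> ((g' \<cdot> g) \<cdot> f)"
    using cmp_assoc[OF cmp_hom[OF f(1) g(1)] g'(1) f'(1)] cmp_assoc[OF f(1) g(1) g'(1)] by simp
  also have "\<dots> = Idn C x" using f'(2) g'(2) idn_left[OF f(1)] by simp
  finally have 1: "(f' \<cdot> g') \<cdot> (g \<cdot> f) = Idn C x" .
  have "(g \<cdot> f) \<cdot> (f' \<cdot> g') = g \<cdot> ((f \<cdot> f') \<cdot> g')"
    using cmp_assoc[OF cmp_hom[OF g'(1) f'(1)] f(1) g(1)] cmp_assoc[OF g'(1) f'(1) f(1)] by simp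
  also have "\<dots> = Idn C z" using f'(3) g'(3) idn_left[OF g'(1)] by simp
  finally have 2: "(g \<cdot> f) \<cdot> (f' \<cdot> g') = Idn C z" .
  show ?thesis
    using is_isoI[OF cmp_hom[OF f(1) g(1)] cmp_hom[OF g'(1) f'(1)] 1 2] .
qed

lemma iso_cancel_left:
  assumes h: "is_iso C h" "h \<in> hom C y z" and fg: "f \<in> hom C x y" "g \<in> hom C x y"
    and eq: "h \<cdot> f = h \<cdot> g"
  shows "f = g"
proof -
  obtain k where k: "k \<in> hom C z y" "k \<cdot> h = Idn C y" using h by (auto elim: is_isoE)
  have "f = k \<cdot> (h \<cdot> f)" using cmp_assoc[OF fg(1) h(2) k(1)] k(2) idn_left[OF fg(1)] by simp
  also have "\<dots> = g"
    using cmp_assoc[OF fg(2) h(2) k(1)] k(2) idn_left[OF fg(2)] eq by simp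
  finally show ?thesis .
qed

lemma category_full_subcat:
  assumes "S \<subseteq> Obj C"
  shows "category (full_subcat C S)"
  using assms idn_hom cmp_hom idn_left idn_right cmp_assoc
  by unfold_locales (simp_all add: hom_full_subcat, auto simp: full_subcat_def)

end

lemma full_subcat_simps [simp]:
  "Obj (full_subcat C S) = S"
  "Idn (full_subcat C S) = Idn C"
  "Cmp (full_subcat C S) = Cmp C"
  by (simp_all add: full_subcat_def)

lemma fctr_simps [simp]:
  "omap id_fctr x = x" "amap id_fctr f = f"
  "omap (G \<circ>\<^sub>F F) x = omap G (omap F x)" "amap (G \<circ>\<^sub>F F) f = amap G (amap F f)"
  by (simp_all add: id_fctr_def comp_fctr_def)

lemma (in cat_functor) is_iso_amap:
  assumes "is_iso C f"
  shows "is_iso D (amap F f)"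
proof -
  have f: "f \<in> hom C (Dom C f) (Cod C f)" using assms by (simp add: is_iso_def hom_def)
  then obtain g where g: "g \<in> hom C (Cod C f) (Dom C f)"
    "g \<cdot>\<^bsub>C\<^esub> f = Idn C (Dom C f)" "f \<cdot>\<^bsub>C\<^esub> g = Idn C (Cod C f)"
    using assms by (auto elim: is_isoE)
  have "Dom C f \<in> Obj C" "Cod C f \<in> Obj C" using dom.hom_objs[OF f] by auto
  then show ?thesis
    using is_isoI[OF amap_hom[OF f] amap_hom[OF g(1)]] g(2,3)
      amap_cmp[OF f g(1)] amap_cmp[OF g(1) f] amap_idn by simp
qed

text \<open>Needed because \<open>localization\<close> determines its functor only up to
  \<open>fctr_eq\<close>; the functor laws mention only objects and arrows of the source, so they
  carry over.\<close>

lemma (in cat_functor) cat_functor_cong: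
  assumes "fctr_eq C F G"
  shows "cat_functor C D G"
proof -
  have o: "x \<in> Obj C \<Longrightarrow> omap G x = omap F x" and a: "f \<in> Arr C \<Longrightarrow> amap G f = amap F f" for x f
    using assms by (simp_all add: fctr_eq_def)
  show ?thesis
  proof
    fix f x y assume f: "f \<in> hom C x y"
    show "amap G f \<in> hom D (omap G x) (omap G y)"
      using amap_hom[OF f] o dom.hom_objs[OF f] a homD(1)[OF f] by simp
  next
    fix f g x y z assume f: "f \<in> hom C x y" and g: "g \<in> hom C y z"
    show "amap G (g \<cdot>\<^bsub>C\<^esub> f) = amap G g \<cdot>\<^bsub>D\<^esub> amap G f"
      using amap_cmp[OF f g] a homD(1)[OF f] homD(1)[OF g] homD(1)[OF dom.cmp_hom[OF f g]] by simp
  next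
    fix x assume x: "x \<in> Obj C"
    show "amap G (Idn C x) = Idn D (omap G x)"
      using amap_idn[OF x] o[OF x] a homD(1)[OF dom.idn_hom[OF x]] by simp
  qed (simp add: o omap_obj)
qed

lemma (in category) cat_functor_id: "cat_functor C C id_fctr"
  by unfold_locales simp_all

lemma cat_functor_comp:
  assumes "cat_functor C D F" "cat_functor D E G"
  shows "cat_functor C E (G \<circ>\<^sub>F F)"
proof -
  interpret F: cat_functor C D F by fact
  interpret G: cat_functor D E G by fact
  show ?thesis
    by unfold_locales
      (simp_all add: F.omap_obj G.omap_obj F.amap_idn G.amap_idn F.amap_cmp F.amap_hom G.amap_hom
        G.amap_cmp[OF F.amap_hom F.amap_hom])
qed


section \<open>Localizations as idempotent monads\<close>

text \<open>The multiplication is no separate datum: it is forced to be the inverse of the unit at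
  \<open>omap L x\<close>, and \<open>amap_unit\<close> states that the two canonical maps from L x
  to L L x coincide.\<close>

locale idempotent_monad = nat_trans C C id_fctr L l
  for C :: "('o, 'm) cat" (structure) and L l +
  assumes unit_iso: "x \<in> Obj C \<Longrightarrow> is_iso C (l (omap L x))"
    and amap_unit: "x \<in> Obj C \<Longrightarrow> amap L (l x) = l (omap L x)"
begin

lemmas L_hom = target.amap_hom
lemmas L_obj = target.omap_obj

lemma unit_hom: "x \<in> Obj C \<Longrightarrow> l x \<in> hom C x (omap L x)"
  using component by simp

lemma unit_natural: "f \<in> hom C x y \<Longrightarrow> amap L f \<cdot> l x = l y \<cdot> f"
  using naturality by simp

lemma local_L: "x \<in> Obj C \<Longrightarrow> local_obj C l (omap L x)"
  by (simp add: local_obj_def unit_iso L_obj)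

lemma unit_equiv: "x \<in> Obj C \<Longrightarrow> is_iso C (amap L (l x))"
  by (simp add: unit_iso amap_unit)

text \<open>Naturality and \<open>amap_unit\<close> give
  \<open>amap L (h \<cdot> l x) = l y \<cdot> h\<close> for every \<open>h\<close> from L x to y. So
  \<open>h \<cdot> l x\<close> determines \<open>l y \<cdot> h\<close>, and \<open>l y\<close> can
  be cancelled since y is local.\<close>

lemma extension_unique:
  assumes x: "x \<in> Obj C" and y: "local_obj C l y"
    and f: "f \<in> hom C (omap L x) y" and g: "g \<in> hom C (omap L x) y"
    and eq: "f \<cdot> l x = g \<cdot> l x"
  shows "f = g"
proof -
  have lift: "amap L (h \<cdot> l x) = l y \<cdot> h" if h: "h \<in> hom C (omap L x) y" for h
    using unit_natural[OF h] target.amap_cmp[OF unit_hom[OF x] h] amap_unit[OF x] by simp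
  have "l y \<cdot> f = l y \<cdot> g" using lift[OF f] lift[OF g] eq by simp
  moreover have "is_iso C (l y)" "l y \<in> hom C y (omap L y)"
    using y unit_hom by (auto simp: local_obj_def)
  ultimately show ?thesis using source.dom.iso_cancel_left f g by metis
qed

text \<open>The extension is \<open>l z\<close>, followed by the inverse of \<open>amap L u\<close>,
  then \<open>amap L f\<close>, then the inverse of \<open>l y\<close>. An arbitrary equivalence
  \<open>u\<close> covers both the units \<open>l x\<close> and the arrow underlying the unit of a
  localization on coalgebras.\<close>

lemma extension_along_equiv:
  assumes u: "u \<in> hom C x z" "is_iso C (amap L u)" and y: "local_obj C l y"
    and f: "f \<in> hom C x y"
  obtains e where "e \<in> hom C z y" "e \<cdot> u = f"
proof -
  note [intro] = source.dom.cmp_hom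
  have obj: "x \<in> Obj C" "y \<in> Obj C" "z \<in> Obj C"
    using u f source.dom.hom_objs by auto
  obtain m where m: "m \<in> hom C (omap L y) y" "m \<cdot> l y = Idn C y"
    using y unit_hom[of y] by (auto simp: local_obj_def elim: is_isoE)
  obtain v where v: "v \<in> hom C (omap L z) (omap L x)" "v \<cdot> amap L u = Idn C (omap L x)"
    using u L_hom[OF u(1)] by (auto elim: is_isoE)
  have Lf: "amap L f \<in> hom C (omap L x) (omap L y)" and Lu: "amap L u \<in> hom C (omap L x) (omap L z)"
    using L_hom f u by auto
  have lx: "l x \<in> hom C x (omap L x)" and ly: "l y \<in> hom C y (omap L y)"
    and lz: "l z \<in> hom C z (omap L z)"
    using unit_hom obj by auto
  \<comment> \<open>Naturality of the unit at \<open>u\<close> moves \<open>u\<close> under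
    \<open>L\<close>, where \<open>v\<close> cancels it.\<close>
  have vlu: "(v \<cdot> l z) \<cdot> u = l x"
  proof -
    have "(v \<cdot> l z) \<cdot> u = v \<cdot> (l z \<cdot> u)" using source.dom.cmp_assoc[OF u(1) lz v(1)] .
    also have "\<dots> = (v \<cdot> amap L u) \<cdot> l x"
      using unit_natural[OF u(1)] source.dom.cmp_assoc[OF lx Lu v(1)] by simp
    finally show ?thesis using v source.dom.idn_left[OF lx] by simp
  qed
  define e where "e = m \<cdot> (amap L f \<cdot> (v \<cdot> l z))"
  have vl: "v \<cdot> l z \<in> hom C z (omap L x)" using v lz by blast
  have fvl: "amap L f \<cdot> (v \<cdot> l z) \<in> hom C z (omap L y)" using vl Lf by blast
  have "e \<cdot> u = m \<cdot> (amap L f \<cdot> ((v \<cdot> l z) \<cdot> u))"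
    unfolding e_def using source.dom.cmp_assoc[OF u(1) fvl m(1)] source.dom.cmp_assoc[OF u(1) vl Lf]
    by simp
  also have "\<dots> = (m \<cdot> l y) \<cdot> f"
    using vlu unit_natural[OF f] source.dom.cmp_assoc[OF f ly m(1)] by simp
  finally have "e \<cdot> u = f" using m source.dom.idn_left[OF f] by simp
  moreover have "e \<in> hom C z y" unfolding e_def using fvl m by blast
  ultimately show thesis using that by blast
qed

text \<open>Extending \<open>u\<close> along \<open>l x\<close> to \<open>e\<close> gives the
  inverse \<open>r \<cdot> e\<close> of \<open>l x\<close>. One composite is the identity because
  \<open>r\<close> retracts \<open>u\<close>; the other is compared with the identity after
  precomposition with \<open>l x\<close>, its target L x being local.\<close>

lemma local_retract:
  assumes y: "local_obj C l y" and u: "u \<in> hom C x y" and r: "r \<in> hom C y x" "r \<cdot> u = Idn C x"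
  shows "local_obj C l x"
proof -
  note [intro] = source.dom.cmp_hom
  have obj: "x \<in> Obj C" "y \<in> Obj C" using u source.dom.hom_objs by auto
  have lx: "l x \<in> hom C x (omap L x)" using unit_hom obj by auto
  obtain e where e: "e \<in> hom C (omap L x) y" "e \<cdot> l x = u"
    using extension_along_equiv[OF lx unit_equiv[OF obj(1)] y u] .
  have re: "r \<cdot> e \<in> hom C (omap L x) x" using r e by blast
  have left: "(r \<cdot> e) \<cdot> l x = Idn C x"
    using source.dom.cmp_assoc[OF lx e(1) r(1)] e r by simp
  have "l x \<cdot> (r \<cdot> e) = Idn C (omap L x)"
  proof (rule extension_unique[OF obj(1) local_L[OF obj(1)]])
    show "(l x \<cdot> (r \<cdot> e)) \<cdot> l x = Idn C (omap L x) \<cdot> l x"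
      using source.dom.cmp_assoc[OF lx re lx] left source.dom.idn_left[OF lx]
        source.dom.idn_right[OF lx] by simp
  qed (use re lx obj L_obj source.dom.idn_hom in blast)+
  then show ?thesis using is_isoI[OF lx re left] obj by (simp add: local_obj_def)
qed

text \<open>The class of all local objects serves as the reflective subcategory, with
  \<open>L\<close> itself as reflector and the inverses of the units at local objects as
  counit.\<close>

lemma localization: "localization C L l"
proof -
  define S where "S = {x. local_obj C l x}"
  \<comment> \<open>Only the values at local objects are inverses; elsewhere the choice is
    arbitrary.\<close>
  define e where "e x = (SOME g. g \<in> hom C (omap L x) x \<and> g \<cdot> l x = Idn C x \<and>
    l x \<cdot> g = Idn C (omap L x))" for x
  have S: "S \<subseteq> Obj C" by (auto simp: S_def local_obj_def)
  have e: "e x \<in> hom C (omap L x) x" "e x \<cdot> l x = Idn C x" "l x \<cdot> e x = Idn C (omap L x)"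
    if "x \<in> S" for x
  proof -
    have "\<exists>g. g \<in> hom C (omap L x) x \<and> g \<cdot> l x = Idn C x \<and> l x \<cdot> g = Idn C (omap L x)"
      using that unit_hom[of x] by (auto simp: S_def local_obj_def elim: is_isoE)
    from someI_ex[OF this] show "e x \<in> hom C (omap L x) x" "e x \<cdot> l x = Idn C x"
      "l x \<cdot> e x = Idn C (omap L x)" by (simp_all add: e_def)
  qed
  have LS: "omap L x \<in> S" if "x \<in> Obj C" for x
    using local_L that by (simp add: S_def)
  let ?D = "full_subcat C S"
  interpret D: category ?D using source.dom.category_full_subcat[OF S] .
  have K: "cat_functor C ?D L"
    by unfold_locales
      (auto simp: LS hom_full_subcat L_hom target.amap_idn target.amap_cmp
        dest: source.dom.hom_objs)
  have J: "cat_functor ?D C id_fctr"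
    by unfold_locales (use S in \<open>auto simp: hom_full_subcat\<close>)
  have unit: "nat_trans C C id_fctr (id_fctr \<circ>\<^sub>F L) l"
  proof (intro nat_trans.intro nat_trans_axioms.intro cat_functor_comp[OF K J])
    show "cat_functor C C id_fctr" using source.dom.cat_functor_id .
  qed (auto simp: unit_hom unit_natural)
  have counit: "nat_trans ?D ?D (L \<circ>\<^sub>F id_fctr) id_fctr e"
  proof (intro nat_trans.intro nat_trans_axioms.intro cat_functor_comp[OF J K])
    show "cat_functor ?D ?D id_fctr" using D.cat_functor_id .
  next
    fix x assume "x \<in> Obj ?D"
    then show "e x \<in> hom ?D (omap (L \<circ>\<^sub>F id_fctr) x) (omap id_fctr x)"
      using e LS S by (auto simp: hom_full_subcat)
  next
    fix f x y assume "f \<in> hom ?D x y"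
    then have f: "f \<in> hom C x y" "x \<in> S" "y \<in> S" by (auto simp: hom_full_subcat)
    note ex = e[OF f(2)] and ey = e[OF f(3)]
    have obj: "x \<in> Obj C" "y \<in> Obj C" using f S by auto
    have Lf: "amap L f \<in> hom C (omap L x) (omap L y)" using L_hom f by blast
    \<comment> \<open>Both sides of the naturality square run from L x to the local object y, so
      they may be compared after precomposition with \<open>l x\<close>.\<close>
    have "(f \<cdot> e x) \<cdot> l x = (e y \<cdot> amap L f) \<cdot> l x"
    proof -
      have "(f \<cdot> e x) \<cdot> l x = f"
        using source.dom.cmp_assoc[OF unit_hom[OF obj(1)] ex(1) f(1)] ex(2)
          source.dom.idn_right[OF f(1)] by simp
      also have "\<dots> = (e y \<cdot> l y) \<cdot> f" using ey source.dom.idn_left[OF f(1)] by simp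
      also have "\<dots> = (e y \<cdot> amap L f) \<cdot> l x"
        using source.dom.cmp_assoc[OF f(1) unit_hom[OF obj(2)] ey(1)]
          source.dom.cmp_assoc[OF unit_hom[OF obj(1)] Lf ey(1)] unit_natural[OF f(1)] by simp
      finally show ?thesis .
    qed
    then have "f \<cdot> e x = e y \<cdot> amap L f"
      using extension_unique[OF obj(1)] f(3) source.dom.cmp_hom[OF ex(1) f(1)]
        source.dom.cmp_hom[OF Lf ey(1)] by (auto simp: S_def)
    then show "amap id_fctr f \<cdot>\<^bsub>?D\<^esub> e x = e y \<cdot>\<^bsub>?D\<^esub> amap (L \<circ>\<^sub>F id_fctr) f" by simp
  qed
  \<comment> \<open>By \<open>amap_unit\<close> the left triangle becomes
    \<open>e (omap L x) \<cdot> l (omap L x)\<close>; both triangles then say that \<open>e\<close>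
    is a left inverse of the unit.\<close>
  have "adjunction C ?D L id_fctr l e"
    using K J unit counit e LS amap_unit S
    by (auto intro!: adjunction.intro adjunction_axioms.intro)
  then show ?thesis
    unfolding localization_def Let_def using S
    by (intro exI[of _ S] exI[of _ L] exI[of _ e]) (simp add: fctr_eq_def)
qed

end

text \<open>The counit inverts the unit at objects of the subcategory: one composite is the right
  triangle, the other comes from naturality of the counit at \<open>l y\<close> and the left
  triangle. Since the reflector takes values in the subcategory, \<open>unit_iso\<close>
  follows.\<close>

lemma localization_imp_idempotent_monad:
  assumes "localization C L l"
  shows "idempotent_monad C L l"
proof -
  obtain S K e where S: "S \<subseteq> Obj C" and adj: "adjunction C (full_subcat C S) K id_fctr l e"
    and eq: "fctr_eq C L (id_fctr \<circ>\<^sub>F K)"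
    using assms by (auto simp: localization_def Let_def)
  interpret adjunction C "full_subcat C S" K id_fctr l e by fact
  have eqs: "x \<in> Obj C \<Longrightarrow> omap L x = omap K x" "f \<in> Arr C \<Longrightarrow> amap L f = amap K f" for x f
    using eq by (simp_all add: fctr_eq_def)
  have KS: "omap K x \<in> S" if "x \<in> Obj C" for x using left.omap_obj[OF that] by simp
  have L: "cat_functor C C L"
    using unit.target.cat_functor_cong eq by (simp add: fctr_eq_def)
  interpret L: cat_functor C C L by fact
  have l: "l x \<in> hom C x (omap K x)" if "x \<in> Obj C" for x using unit.component[OF that] by simp
  have inv: "e y \<in> hom C (omap K y) y" "e y \<cdot>\<^bsub>C\<^esub> l y = Idn C y" "l y \<cdot>\<^bsub>C\<^esub> e y = Idn C (omap K y)"
    if y: "y \<in> S" for y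
  proof -
    have yC: "y \<in> Obj C" using y S by auto
    show "e y \<in> hom C (omap K y) y"
      using counit.component[of y] y by (simp add: hom_full_subcat)
    show "e y \<cdot>\<^bsub>C\<^esub> l y = Idn C y" using triangle_right[of y] y by simp
    \<comment> \<open>Fullness puts \<open>l y\<close> into the subcategory, so that naturality of
      the counit applies to it.\<close>
    have "l y \<in> hom (full_subcat C S) y (omap K y)"
      using l[OF yC] y KS[OF yC] by (simp add: hom_full_subcat)
    from counit.naturality[OF this] show "l y \<cdot>\<^bsub>C\<^esub> e y = Idn C (omap K y)"
      using triangle_left[OF yC] by simp
  qed
  show ?thesis
  proof
    fix x assume x: "x \<in> Obj C"
    show "l x \<in> hom C (omap id_fctr x) (omap L x)" using l[OF x] eqs x by simp
    let ?y = "omap K x"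
    have y: "?y \<in> S" "?y \<in> Obj C" using KS x S by auto
    show "is_iso C (l (omap L x))"
      using is_isoI[OF l[OF y(2)] inv[OF y(1)]] eqs(1)[OF x] by simp
    have Kl: "amap K (l x) \<in> hom C ?y (omap K ?y)"
      using left.amap_hom[OF l[OF x]] by (simp add: hom_full_subcat)
    \<comment> \<open>The identity \<open>l ?y \<cdot> e ?y\<close> is inserted; the left triangle
      then cancels \<open>e ?y\<close> against \<open>amap K (l x)\<close> and leaves
      \<open>l ?y\<close>.\<close>
    have "amap K (l x) = (l ?y \<cdot>\<^bsub>C\<^esub> e ?y) \<cdot>\<^bsub>C\<^esub> amap K (l x)"
      using inv[OF y(1)] left.dom.idn_left[OF Kl] by simp
    also have "\<dots> = l ?y"
      using left.dom.cmp_assoc[OF Kl inv(1)[OF y(1)] l[OF y(2)]] triangle_left[OF x]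
        left.dom.idn_right[OF l[OF y(2)]] by simp
    finally show "amap L (l x) = l (omap L x)"
      using eqs x homD(1)[OF l[OF x]] by simp
  next
    fix f x y assume f: "f \<in> hom C x y"
    show "amap L f \<cdot>\<^bsub>C\<^esub> l x = l y \<cdot>\<^bsub>C\<^esub> amap id_fctr f"
      using unit.naturality[OF f] eqs(2)[OF homD(1)[OF f]] by simp
  qed
qed

lemma localization_iff_idempotent_monad: "localization C L l \<longleftrightarrow> idempotent_monad C L l"
  using localization_imp_idempotent_monad idempotent_monad.localization by blast


section \<open>The category of coalgebras\<close>

lemma coalg_cat_simps [simp]:
  "A \<in> Obj (coalg_cat C T \<epsilon> \<delta>) \<longleftrightarrow> coalgebra C T \<epsilon> \<delta> A"
  "Idn (coalg_cat C T \<epsilon> \<delta>) A = (A, Idn C (fst A), A)"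
  "Cmp (coalg_cat C T \<epsilon> \<delta>) (B, h, D) (A, g, B') = (A, h \<cdot>\<^bsub>C\<^esub> g, D)"
  by (simp_all add: coalg_cat_def)

lemma hom_coalg_cat:
  "f \<in> hom (coalg_cat C T \<epsilon> \<delta>) A B \<longleftrightarrow>
    (\<exists>g. f = (A, g, B) \<and> coalgebra C T \<epsilon> \<delta> A \<and> coalgebra C T \<epsilon> \<delta> B \<and> coalg_hom C T A B g)"
  by (cases A; cases B) (auto simp: hom_def coalg_cat_def)

lemma forget_simps [simp]: "omap forget A = fst A" "amap forget (A, g, B) = g"
  by (simp_all add: forget_def)

lemma coalgebra_iff:
  "coalgebra C T \<epsilon> \<delta> A \<longleftrightarrow> fst A \<in> Obj C \<and> snd A \<in> hom C (fst A) (omap T (fst A)) \<and>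
     amap T (snd A) \<cdot>\<^bsub>C\<^esub> snd A = \<delta> (fst A) \<cdot>\<^bsub>C\<^esub> snd A \<and>
     \<epsilon> (fst A) \<cdot>\<^bsub>C\<^esub> snd A = Idn C (fst A)"
  by (simp add: coalgebra_def split_beta)

lemma coalg_hom_iff:
  "coalg_hom C T A B g \<longleftrightarrow>
     g \<in> hom C (fst A) (fst B) \<and> amap T g \<cdot>\<^bsub>C\<^esub> snd A = snd B \<cdot>\<^bsub>C\<^esub> g"
  by (simp add: coalg_hom_def split_beta)

locale comonad_on_category = category C + comonad C T \<epsilon> \<delta>
  for C :: "('o, 'm) cat" (structure) and T \<epsilon> \<delta>
begin

abbreviation CT where "CT \<equiv> coalg_cat C T \<epsilon> \<delta>"
abbreviation coalg where "coalg \<equiv> coalgebra C T \<epsilon> \<delta>"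

lemmas T_hom = counit.source.amap_hom
lemmas T_cmp = counit.source.amap_cmp
lemmas T_obj = counit.source.omap_obj

lemma coalgD:
  assumes "coalg A"
  shows "fst A \<in> Obj C" "snd A \<in> hom C (fst A) (omap T (fst A))"
    "amap T (snd A) \<cdot> snd A = \<delta> (fst A) \<cdot> snd A" "\<epsilon> (fst A) \<cdot> snd A = Idn C (fst A)"
  using assms by (simp_all add: coalgebra_iff)

lemma counit_hom: "x \<in> Obj C \<Longrightarrow> \<epsilon> x \<in> hom C (omap T x) x"
  using counit.component by simp

lemma counit_natural: "f \<in> hom C x y \<Longrightarrow> f \<cdot> \<epsilon> x = \<epsilon> y \<cdot> amap T f"
  using counit.naturality by simp

lemma comult_hom: "x \<in> Obj C \<Longrightarrow> \<delta> x \<in> hom C (omap T x) (omap T (omap T x))"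
  using comult.component by simp

lemma comult_natural: "f \<in> hom C x y \<Longrightarrow> amap T (amap T f) \<cdot> \<delta> x = \<delta> y \<cdot> amap T f"
  using comult.naturality by simp

lemma coalg_hom_idn:
  assumes "coalg A"
  shows "coalg_hom C T A A (Idn C (fst A))"
  using coalgD[OF assms]
  by (simp add: coalg_hom_iff idn_hom counit.source.amap_idn idn_right[where y = "omap T (fst A)"]
      idn_left[where x = "fst A"])

lemma coalg_hom_cmp:
  assumes A: "coalg A" and B: "coalg B" and D: "coalg D"
    and g: "coalg_hom C T A B g" and h: "coalg_hom C T B D h"
  shows "coalg_hom C T A D (h \<cdot> g)"
proof -
  have gh: "g \<in> hom C (fst A) (fst B)" "h \<in> hom C (fst B) (fst D)"
    and eq: "amap T g \<cdot> snd A = snd B \<cdot> g" "amap T h \<cdot> snd B = snd D \<cdot> h"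
    using g h by (simp_all add: coalg_hom_iff)
  note a = coalgD(2)[OF A] and b = coalgD(2)[OF B] and d = coalgD(2)[OF D]
  have "amap T (h \<cdot> g) \<cdot> snd A = amap T h \<cdot> (amap T g \<cdot> snd A)"
    using T_cmp[OF gh] cmp_assoc[OF a T_hom[OF gh(1)] T_hom[OF gh(2)]] by simp
  also have "\<dots> = (amap T h \<cdot> snd B) \<cdot> g"
    using eq(1) cmp_assoc[OF gh(1) b T_hom[OF gh(2)]] by simp
  also have "\<dots> = snd D \<cdot> (h \<cdot> g)"
    using eq(2) cmp_assoc[OF gh d] by simp
  finally show ?thesis using cmp_hom[OF gh] by (simp add: coalg_hom_iff)
qed

lemma category_coalg_cat: "category CT"
proof
  fix f assume "f \<in> Arr CT"
  then show "Dom CT f \<in> Obj CT" "Cod CT f \<in> Obj CT" by (auto simp: coalg_cat_def)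
next
  fix A assume "A \<in> Obj CT"
  then show "Idn CT A \<in> hom CT A A" by (simp add: hom_coalg_cat coalg_hom_idn)
next
  fix f g A B D assume "f \<in> hom CT A B" "g \<in> hom CT B D"
  then show "g \<cdot>\<^bsub>CT\<^esub> f \<in> hom CT A D" by (auto simp: hom_coalg_cat intro: coalg_hom_cmp)
next
  fix f A B assume "f \<in> hom CT A B"
  then show "Idn CT B \<cdot>\<^bsub>CT\<^esub> f = f" "f \<cdot>\<^bsub>CT\<^esub> Idn CT A = f"
    using idn_left idn_right by (fastforce simp: hom_coalg_cat coalg_hom_iff)+
next
  fix f g h A B D E assume "f \<in> hom CT A B" "g \<in> hom CT B D" "h \<in> hom CT D E"
  then show "(h \<cdot>\<^bsub>CT\<^esub> g) \<cdot>\<^bsub>CT\<^esub> f = h \<cdot>\<^bsub>CT\<^esub> (g \<cdot>\<^bsub>CT\<^esub> f)"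
    using cmp_assoc by (fastforce simp: hom_coalg_cat coalg_hom_iff)
qed

sublocale CT: category CT
  by (rule category_coalg_cat)

lemma cat_functor_forget: "cat_functor CT C forget"
  by unfold_locales (auto simp: hom_coalg_cat coalg_hom_iff coalgD)

sublocale U: cat_functor CT C forget
  by (rule cat_functor_forget)

text \<open>For reflection, the inverse \<open>k\<close> of an underlying arrow \<open>g\<close>
  must be a coalgebra morphism. It is, because the square for \<open>g\<close> can be composed with
  \<open>k\<close> on one side and with \<open>amap T k\<close> on the other.\<close>

lemma is_iso_coalg_iff:
  assumes "f \<in> hom CT A B"
  shows "is_iso CT f \<longleftrightarrow> is_iso C (amap forget f)"
proof
  assume "is_iso CT f"
  then show "is_iso C (amap forget f)" by (rule U.is_iso_amap)
next
  assume iso: "is_iso C (amap forget f)"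
  obtain g where f: "f = (A, g, B)" and A: "coalg A" and B: "coalg B"
    and g: "g \<in> hom C (fst A) (fst B)" "amap T g \<cdot> snd A = snd B \<cdot> g"
    using assms by (auto simp: hom_coalg_cat coalg_hom_iff)
  obtain k where k: "k \<in> hom C (fst B) (fst A)" "k \<cdot> g = Idn C (fst A)" "g \<cdot> k = Idn C (fst B)"
    using iso g(1) f by (auto elim: is_isoE)
  note a = coalgD(2)[OF A] and b = coalgD(2)[OF B] and obj = coalgD(1)[OF A] coalgD(1)[OF B]
  have ka: "snd A \<cdot> k \<in> hom C (fst B) (omap T (fst A))" using cmp_hom[OF k(1) a] .
  have "amap T k \<cdot> snd B = amap T k \<cdot> (snd B \<cdot> (g \<cdot> k))"
    using k(3) idn_right[OF b] by simp
  also have "\<dots> = amap T k \<cdot> ((snd B \<cdot> g) \<cdot> k)"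
    using cmp_assoc[OF k(1) g(1) b] by simp
  also have "\<dots> = amap T k \<cdot> (amap T g \<cdot> (snd A \<cdot> k))"
    using cmp_assoc[OF k(1) a T_hom[OF g(1)]] g(2) by simp
  also have "\<dots> = amap T (k \<cdot> g) \<cdot> (snd A \<cdot> k)"
    using cmp_assoc[OF ka T_hom[OF g(1)] T_hom[OF k(1)]] T_cmp[OF g(1) k(1)] by simp
  also have "\<dots> = snd A \<cdot> k"
    using k(2) counit.source.amap_idn[OF obj(1)] idn_left[OF ka] by simp
  finally have "(B, k, A) \<in> hom CT B A"
    using A B k(1) by (simp add: hom_coalg_cat coalg_hom_iff)
  then show "is_iso CT f"
    using is_isoI[OF assms] k f by simp
qed

text \<open>The laws \<open>coassoc\<close> and \<open>counit_left\<close> are the two coalgebra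
  axioms here. The cofree coalgebra is the test object through which a localization on coalgebras
  gives information about \<open>T\<close>.\<close>

lemma coalgebra_cofree:
  assumes "x \<in> Obj C"
  shows "coalg (omap T x, \<delta> x)"
  using assms coassoc counit_left comult_hom T_obj by (simp add: coalgebra_iff)

end


section \<open>Lifting a localization to coalgebras\<close>

locale comonad_localization = comonad_on_category C T \<epsilon> \<delta> + L: idempotent_monad C L l
  for C :: "('o, 'm) cat" (structure) and T \<epsilon> \<delta> L l
begin

section \<open>Coalgebra structures on L X compatible with the unit\<close>

definition unit_struct :: "'o \<times> 'm \<Rightarrow> 'm \<Rightarrow> bool" where
  "unit_struct A c \<longleftrightarrow>
     coalg (omap L (fst A), c) \<and> coalg_hom C T A (omap L (fst A), c) (l (fst A))"

text \<open>The choice is canonical once \<open>T\<close> preserves local objects, since then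
  exactly one such structure exists on each coalgebra.\<close>

definition lift_struct :: "'o \<times> 'm \<Rightarrow> 'm" where
  "lift_struct A = (SOME c. unit_struct A c)"

text \<open>For \<open>A = (x, a)\<close> the morphism condition forces
  \<open>c \<cdot> l x = amap T (l x) \<cdot> a\<close>, and a map from L x into the local object T
  L x is determined by this composite.\<close>

lemma unit_struct_unique:
  assumes T: "preserves_local_objs C l C l T" and A: "coalg A"
    and "unit_struct A c" "unit_struct A d"
  shows "c = d"
proof (rule L.extension_unique)
  show "fst A \<in> Obj C" using coalgD[OF A] by simp
  then show "local_obj C l (omap T (omap L (fst A)))"
    using T L.local_L L.L_obj by (simp add: preserves_local_objs_def)
qed (use assms(3,4) in \<open>auto simp: unit_struct_def coalgebra_iff coalg_hom_iff\<close>)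

text \<open>Both coalgebra laws compare maps from L x into local objects, so they may be tested
  after \<open>l x\<close>. There, naturality of \<delta> and \<epsilon> reduces them to the laws
  for \<open>a\<close>.\<close>

lemma unit_struct_exists:
  assumes T: "preserves_local_objs C l C l T" and A: "coalg A"
  shows "\<exists>c. unit_struct A c"
proof -
  obtain x a where xa: "A = (x, a)" by fastforce
  have x: "x \<in> Obj C" and a: "a \<in> hom C x (omap T x)"
    and aa: "amap T a \<cdot> a = \<delta> x \<cdot> a" and ea: "\<epsilon> x \<cdot> a = Idn C x"
    using coalgD[OF A] xa by simp_all
  let ?y = "omap L x"
  have y: "?y \<in> Obj C" using x L.L_obj by simp
  have ly: "local_obj C l ?y" using x L.local_L by simp
  have lTy: "local_obj C l (omap T ?y)" using ly T y by (simp add: preserves_local_objs_def)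
  \<comment> \<open>The comultiplication law takes values in T T L x, so preservation of local
    objects is applied twice.\<close>
  have lTTy: "local_obj C l (omap T (omap T ?y))"
    using lTy T T_obj[OF y] by (simp add: preserves_local_objs_def)
  note lx = L.unit_hom[OF x]
  note Tl = T_hom[OF lx]
  \<comment> \<open>As the extension of \<open>amap T (l x) \<cdot> a\<close> along
    \<open>l x\<close>, the map \<open>c\<close> makes the unit a coalgebra morphism by
    construction.\<close>
  obtain c where c: "c \<in> hom C ?y (omap T ?y)" "c \<cdot> l x = amap T (l x) \<cdot> a"
    using L.extension_along_equiv[OF lx L.unit_equiv[OF x] lTy cmp_hom[OF a Tl]] .
  note Tc = T_hom[OF c(1)]
  have "(amap T c \<cdot> c) \<cdot> l x = (\<delta> ?y \<cdot> c) \<cdot> l x"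
  proof -
    have "(amap T c \<cdot> c) \<cdot> l x = amap T c \<cdot> (amap T (l x) \<cdot> a)"
      using cmp_assoc[OF lx c(1) Tc] c(2) by simp
    also have "\<dots> = amap T (c \<cdot> l x) \<cdot> a"
      using cmp_assoc[OF a Tl Tc] T_cmp[OF lx c(1)] by simp
    also have "\<dots> = amap T (amap T (l x)) \<cdot> (amap T a \<cdot> a)"
      using c(2) T_cmp[OF a Tl] cmp_assoc[OF a T_hom[OF a] T_hom[OF Tl]] by simp
    also have "\<dots> = (amap T (amap T (l x)) \<cdot> \<delta> x) \<cdot> a"
      using aa cmp_assoc[OF a comult_hom[OF x] T_hom[OF Tl]] by simp
    also have "\<dots> = \<delta> ?y \<cdot> (amap T (l x) \<cdot> a)"
      using comult_natural[OF lx] cmp_assoc[OF a Tl comult_hom[OF y]] by simp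
    also have "\<dots> = (\<delta> ?y \<cdot> c) \<cdot> l x"
      using c(2) cmp_assoc[OF lx c(1) comult_hom[OF y]] by simp
    finally show ?thesis .
  qed
  from L.extension_unique[OF x lTTy cmp_hom[OF c(1) Tc] cmp_hom[OF c(1) comult_hom[OF y]] this]
  have cc: "amap T c \<cdot> c = \<delta> ?y \<cdot> c" .
  have "(\<epsilon> ?y \<cdot> c) \<cdot> l x = Idn C ?y \<cdot> l x"
  proof -
    have "(\<epsilon> ?y \<cdot> c) \<cdot> l x = (\<epsilon> ?y \<cdot> amap T (l x)) \<cdot> a"
      using cmp_assoc[OF lx c(1) counit_hom[OF y]] c(2) cmp_assoc[OF a Tl counit_hom[OF y]] by simp
    also have "\<dots> = l x \<cdot> (\<epsilon> x \<cdot> a)"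
      using counit_natural[OF lx] cmp_assoc[OF a counit_hom[OF x] lx] by simp
    also have "\<dots> = Idn C ?y \<cdot> l x" using ea idn_right[OF lx] idn_left[OF lx] by simp
    finally show ?thesis .
  qed
  from L.extension_unique[OF x ly cmp_hom[OF c(1) counit_hom[OF y]] idn_hom[OF y] this]
  have "\<epsilon> ?y \<cdot> c = Idn C ?y" .
  then show ?thesis
    using cc c lx y xa by (auto simp: unit_struct_def coalgebra_iff coalg_hom_iff)
qed

lemma unit_struct_lift_struct:
  assumes "preserves_local_objs C l C l T" "coalg A"
  shows "unit_struct A (lift_struct A)"
  unfolding lift_struct_def using someI_ex[OF unit_struct_exists[OF assms]] .

text \<open>The two sides of the square for \<open>amap L g\<close> end in the local object T L y,
  so they may be compared after the unit. There the square follows from those of \<open>g\<close>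
  and of the two units, together with naturality of \<open>l\<close>.\<close>

lemma coalg_hom_L:
  assumes T: "preserves_local_objs C l C l T" and A: "coalg A" and B: "coalg B"
    and g: "coalg_hom C T A B g" and c: "unit_struct A c" and d: "unit_struct B d"
  shows "coalg_hom C T (omap L (fst A), c) (omap L (fst B), d) (amap L g)"
proof -
  let ?x = "fst A" and ?y = "fst B"
  have x: "?x \<in> Obj C" and y: "?y \<in> Obj C" using coalgD A B by auto
  note a = coalgD(2)[OF A] and b = coalgD(2)[OF B]
  note lx = L.unit_hom[OF x] and ly = L.unit_hom[OF y]
  have g': "g \<in> hom C ?x ?y" "amap T g \<cdot> snd A = snd B \<cdot> g"
    using g by (simp_all add: coalg_hom_iff)
  have c': "c \<in> hom C (omap L ?x) (omap T (omap L ?x))" "amap T (l ?x) \<cdot> snd A = c \<cdot> l ?x"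
    using c by (simp_all add: unit_struct_def coalgebra_iff coalg_hom_iff)
  have d': "d \<in> hom C (omap L ?y) (omap T (omap L ?y))" "amap T (l ?y) \<cdot> snd B = d \<cdot> l ?y"
    using d by (simp_all add: unit_struct_def coalgebra_iff coalg_hom_iff)
  note Lg = L.L_hom[OF g'(1)]
  have local: "local_obj C l (omap T (omap L ?y))"
    using T L.local_L[OF y] L.L_obj[OF y] by (simp add: preserves_local_objs_def)
  have "(amap T (amap L g) \<cdot> c) \<cdot> l ?x = amap T (amap L g) \<cdot> (amap T (l ?x) \<cdot> snd A)"
    using cmp_assoc[OF lx c'(1) T_hom[OF Lg]] c'(2) by simp
  also have "\<dots> = amap T (l ?y \<cdot> g) \<cdot> snd A"
    using cmp_assoc[OF a T_hom[OF lx] T_hom[OF Lg]] T_cmp[OF lx Lg] L.unit_natural[OF g'(1)]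
    by simp
  also have "\<dots> = (amap T (l ?y) \<cdot> snd B) \<cdot> g"
    using T_cmp[OF g'(1) ly] cmp_assoc[OF a T_hom[OF g'(1)] T_hom[OF ly]] g'(2)
      cmp_assoc[OF g'(1) b T_hom[OF ly]] by simp
  also have "\<dots> = d \<cdot> (amap L g \<cdot> l ?x)"
    using d'(2) cmp_assoc[OF g'(1) ly d'(1)] L.unit_natural[OF g'(1)] by simp
  also have "\<dots> = (d \<cdot> amap L g) \<cdot> l ?x"
    using cmp_assoc[OF lx Lg d'(1)] by simp
  finally have "amap T (amap L g) \<cdot> c = d \<cdot> amap L g"
    using L.extension_unique[OF x local] cmp_hom[OF c'(1) T_hom[OF Lg]] cmp_hom[OF Lg d'(1)] by blast
  then show ?thesis using Lg by (simp add: coalg_hom_iff)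
qed

section \<open>From coalgebra structures to a localization on coalgebras\<close>

definition natural_struct :: "('o \<times> 'm \<Rightarrow> 'm) \<Rightarrow> bool" where
  "natural_struct s \<longleftrightarrow> (\<forall>A. coalg A \<longrightarrow> unit_struct A (s A)) \<and>
     (\<forall>A B g. coalg A \<and> coalg B \<and> coalg_hom C T A B g \<longrightarrow>
        coalg_hom C T (omap L (fst A), s A) (omap L (fst B), s B) (amap L g))"

lemma natural_lift_struct:
  assumes "preserves_local_objs C l C l T"
  shows "natural_struct lift_struct"
  using unit_struct_lift_struct[OF assms] coalg_hom_L[OF assms] by (simp add: natural_struct_def)

text \<open>Equations between coalgebra morphisms with equal endpoints are equations of underlying
  arrows, so the laws of the lift are those of \<open>L\<close> and \<open>l\<close>. Invertibility
  of its unit at localized objects carries over because the forgetful functor reflects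
  isomorphisms.\<close>

lemma natural_struct_imp_lifts:
  assumes s: "natural_struct s"
  shows "\<exists>LT lT. lifts_to_coalgs C T \<epsilon> \<delta> L l LT lT"
proof -
  define M where "M A = (omap L (fst A), s A)" for A
  define LT where "LT = \<lparr>omap = M, amap = (\<lambda>(A, g, B). (M A, amap L g, M B))\<rparr>"
  define lT where "lT A = (A, l (fst A), M A)" for A
  have LT_simps [simp]: "omap LT A = M A" "amap LT (A, g, B) = (M A, amap L g, M B)"
    "fst (M A) = omap L (fst A)" for A g B
    by (simp_all add: LT_def M_def)
  have M: "coalg (M A)" and lM: "coalg_hom C T A (M A) (l (fst A))" if "coalg A" for A
    using s that unfolding natural_struct_def unit_struct_def M_def by blast+
  have LM: "coalg_hom C T (M A) (M B) (amap L g)"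
    if "coalg A" "coalg B" "coalg_hom C T A B g" for A B g
    using s that unfolding natural_struct_def M_def by blast
  have lT: "lT A \<in> hom CT A (M A)" if "coalg A" for A
    using that M lM by (simp add: hom_coalg_cat lT_def)
  have und: "g \<in> hom C (fst A) (fst B)" if "coalg_hom C T A B g" for A B g
    using that by (simp add: coalg_hom_iff)
  interpret LT: idempotent_monad CT LT lT
  proof
    fix f A B assume "f \<in> hom CT A B"
    then show "amap LT f \<in> hom CT (omap LT A) (omap LT B)"
      "amap LT f \<cdot>\<^bsub>CT\<^esub> lT A = lT B \<cdot>\<^bsub>CT\<^esub> amap id_fctr f"
      by (auto simp: hom_coalg_cat M LM lT_def L.unit_natural[OF und])
  next
    fix f g A B D assume "f \<in> hom CT A B" "g \<in> hom CT B D"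
    then show "amap LT (g \<cdot>\<^bsub>CT\<^esub> f) = amap LT g \<cdot>\<^bsub>CT\<^esub> amap LT f"
      by (auto simp: hom_coalg_cat L.target.amap_cmp[OF und und])
  next
    fix A assume "A \<in> Obj CT"
    then have A: "coalg A" by simp
    show "is_iso CT (lT (omap LT A))"
      using is_iso_coalg_iff[OF lT[OF M[OF A]]] L.unit_iso coalgD(1)[OF A] by (simp add: lT_def)
    show "amap LT (lT A) = lT (omap LT A)"
      using L.amap_unit coalgD(1)[OF A] by (simp add: lT_def)
  qed (auto simp: lT M coalgD L.target.amap_idn)
  have "lifts_to_coalgs C T \<epsilon> \<delta> L l LT lT"
    using LT.localization
    by (auto simp: lifts_to_coalgs_def fctr_eq_def lT_def coalg_cat_def)
  then show ?thesis by blast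
qed

text \<open>The equality of functors in \<open>lifts_to_coalgs\<close> is strict, so identity arrows
  serve as components.\<close>

lemma lifts_imp_nat_iso:
  assumes lift: "lifts_to_coalgs C T \<epsilon> \<delta> L l LT lT"
  shows "nat_iso CT C (L \<circ>\<^sub>F forget) (forget \<circ>\<^sub>F LT) (\<lambda>A. Idn C (omap L (fst A)))"
proof -
  interpret LT: idempotent_monad CT LT lT
    using lift by (simp add: lifts_to_coalgs_def localization_iff_idempotent_monad)
  interpret F: cat_functor CT C "L \<circ>\<^sub>F forget"
    using cat_functor_comp[OF U.cat_functor_axioms L.target.cat_functor_axioms] .
  interpret G: cat_functor CT C "forget \<circ>\<^sub>F LT"
    using cat_functor_comp[OF LT.target.cat_functor_axioms U.cat_functor_axioms] .
  have eq: "fst (omap LT A) = omap L (fst A)" if "coalg A" for A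
    using lift that by (simp add: lifts_to_coalgs_def fctr_eq_def)
  have eqa: "amap forget (amap LT f) = amap L (amap forget f)" if "f \<in> Arr CT" for f
    using lift that by (simp add: lifts_to_coalgs_def fctr_eq_def)
  show ?thesis
  proof
    fix A assume "A \<in> Obj CT"
    then have A: "coalg A" by simp
    then have o: "omap L (fst A) \<in> Obj C" using coalgD L.L_obj by simp
    show "Idn C (omap L (fst A)) \<in> hom C (omap (L \<circ>\<^sub>F forget) A) (omap (forget \<circ>\<^sub>F LT) A)"
      using idn_hom[OF o] eq[OF A] by simp
    show "is_iso C (Idn C (omap L (fst A)))" using is_iso_idn[OF o] .
  next
    fix f A B assume f: "f \<in> hom CT A B"
    show "amap (forget \<circ>\<^sub>F LT) f \<cdot> Idn C (omap L (fst A)) =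
        Idn C (omap L (fst B)) \<cdot> amap (L \<circ>\<^sub>F forget) f"
      using idn_right[OF F.amap_hom[OF f]] idn_left[OF F.amap_hom[OF f]] eqa[OF homD(1)[OF f]]
      by simp
  qed
qed

section \<open>From a natural isomorphism back to preservation of local objects\<close>

lemma nat_iso_imp_preserves_local_objs:
  assumes "localization CT LT lT"
    and "nat_iso CT C (L \<circ>\<^sub>F forget) (forget \<circ>\<^sub>F LT) \<theta>"
  shows "preserves_local_objs C l C l T"
  unfolding preserves_local_objs_def
proof (intro ballI impI)
  fix x assume x: "x \<in> Obj C" and loc: "local_obj C l x"
  interpret LT: idempotent_monad CT LT lT
    using assms(1) by (simp add: localization_iff_idempotent_monad)
  interpret \<theta>: nat_iso CT C "L \<circ>\<^sub>F forget" "forget \<circ>\<^sub>F LT" \<theta> by fact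
  define A where "A = (omap T x, \<delta> x)"
  have A: "coalg A" using coalgebra_cofree[OF x] by (simp add: A_def)
  define B where "B = omap LT A"
  have lTA: "lT A \<in> hom CT A B" using LT.unit_hom[of A] A by (simp add: B_def)
  then obtain u where lTu: "lT A = (A, u, B)" and B: "coalg B" and hu: "coalg_hom C T A B u"
    by (auto simp: hom_coalg_cat)
  let ?y = "fst B" and ?b = "snd B"
  have y: "?y \<in> Obj C" and b: "?b \<in> hom C ?y (omap T ?y)" using coalgD[OF B] by auto
  have u: "u \<in> hom C (omap T x) ?y" "amap T u \<cdot> \<delta> x = ?b \<cdot> u"
    using hu by (simp_all add: coalg_hom_iff A_def)
  have \<theta>: "\<theta> D \<in> hom C (omap L (fst D)) (fst (omap LT D))" "is_iso C (\<theta> D)" if "coalg D" for D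
    using \<theta>.component[of D] \<theta>.component_iso[of D] that by simp_all
  have Lu: "amap L u \<in> hom C (omap L (omap T x)) (omap L ?y)" using L.L_hom u by blast
  \<comment> \<open>In the naturality square of \<open>\<theta>\<close> at \<open>lT A\<close>, the
    side coming from \<open>LT\<close> is invertible because \<open>LT\<close> inverts its own
    units. Hence \<open>amap L u\<close> is a composite of isomorphisms.\<close>
  have "is_iso C (amap L u)"
  proof -
    let ?v = "amap forget (amap LT (lT A))"
    have "is_iso CT (amap LT (lT A))" using LT.unit_equiv A by simp
    then have v: "is_iso C ?v" by (rule U.is_iso_amap)
    have vh: "?v \<in> hom C (fst B) (fst (omap LT B))"
      using U.amap_hom[OF LT.L_hom[OF lTA]] by (simp add: B_def)
    have A': "\<theta> A \<in> hom C (omap L (omap T x)) ?y" using \<theta>(1)[OF A] by (simp add: A_def B_def)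
    have nat: "?v \<cdot> \<theta> A = \<theta> B \<cdot> amap L u"
      using \<theta>.naturality[OF lTA] lTu by simp
    have iso: "is_iso C (?v \<cdot> \<theta> A)" using is_iso_cmp[OF A' \<theta>(2)[OF A] vh v] .
    obtain w where w: "w \<in> hom C (fst (omap LT B)) (omap L ?y)" "w \<cdot> \<theta> B = Idn C (omap L ?y)"
      "\<theta> B \<cdot> w = Idn C (fst (omap LT B))"
      using \<theta>[OF B] by (auto elim: is_isoE)
    have "is_iso C (w \<cdot> (?v \<cdot> \<theta> A))"
      using is_iso_cmp[OF cmp_hom[OF A' vh] iso w(1)] is_isoI[OF w(1) \<theta>(1)[OF B] w(3,2)] by blast
    moreover have "w \<cdot> (?v \<cdot> \<theta> A) = amap L u"
      using nat cmp_assoc[OF Lu \<theta>(1)[OF B] w(1)] w(2) idn_left[OF Lu] by simp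
    ultimately show ?thesis by simp
  qed
  then obtain e where e: "e \<in> hom C ?y x" "e \<cdot> u = \<epsilon> x"
    using L.extension_along_equiv[OF u(1) _ loc counit_hom[OF x]] by blast
  note Te = T_hom[OF e(1)]
  \<comment> \<open>Since \<open>u\<close> is a coalgebra morphism, the composite turns into
    \<open>amap T (e \<cdot> u) \<cdot> \<delta> x\<close>, which \<open>counit_right\<close> makes
    the identity because \<open>e \<cdot> u = \<epsilon> x\<close>.\<close>
  have ret: "(amap T e \<cdot> ?b) \<cdot> u = Idn C (omap T x)"
  proof -
    have "(amap T e \<cdot> ?b) \<cdot> u = amap T e \<cdot> (amap T u \<cdot> \<delta> x)"
      using cmp_assoc[OF u(1) b Te] u(2) by simp
    also have "\<dots> = amap T (e \<cdot> u) \<cdot> \<delta> x"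
      using cmp_assoc[OF comult_hom[OF x] T_hom[OF u(1)] Te] T_cmp[OF u(1) e(1)] by simp
    finally show ?thesis using e(2) counit_right[OF x] by simp
  qed
  \<comment> \<open>The isomorphism \<open>\<theta> A\<close> exhibits \<open>?y\<close> as a
    retract of the local object L T x.\<close>
  have local_y: "local_obj C l ?y"
  proof -
    have "\<theta> A \<in> hom C (omap L (fst A)) ?y" using \<theta>(1)[OF A] by (simp add: B_def)
    then obtain w where "w \<in> hom C ?y (omap L (fst A))" "\<theta> A \<cdot> w = Idn C ?y"
      using \<theta>(2)[OF A] by (auto elim: is_isoE)
    then show ?thesis
      using L.local_retract[OF L.local_L[OF coalgD(1)[OF A]]] \<open>\<theta> A \<in> _\<close> by blast
  qed
  show "local_obj C l (omap T x)"
    using L.local_retract[OF local_y u(1) cmp_hom[OF b Te] ret] .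
qed

section \<open>Uniqueness of the lift and its comparison with L\<close>

lemma lifts_unit:
  assumes lift: "lifts_to_coalgs C T \<epsilon> \<delta> L l LT lT" and A: "coalg A"
  obtains c where "omap LT A = (omap L (fst A), c)" "unit_struct A c"
    "lT A = (A, l (fst A), (omap L (fst A), c))" "lT A \<in> hom CT A (omap LT A)"
proof -
  interpret LT: idempotent_monad CT LT lT
    using lift by (simp add: lifts_to_coalgs_def localization_iff_idempotent_monad)
  have lTA: "lT A \<in> hom CT A (omap LT A)" using LT.unit_hom A by simp
  have "fst (omap LT A) = omap L (fst A)" "amap forget (lT A) = l (fst A)"
    using lift A by (simp_all add: lifts_to_coalgs_def fctr_eq_def)
  then show thesis
    using lTA that[of "snd (omap LT A)"]
    by (cases "omap LT A") (auto simp: hom_coalg_cat unit_struct_def)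
qed

lemma lifts_amap:
  assumes lift: "lifts_to_coalgs C T \<epsilon> \<delta> L l LT lT" and f: "f \<in> hom CT A B"
  shows "amap LT f = (omap LT A, amap L (amap forget f), omap LT B)"
    "amap LT f \<in> hom CT (omap LT A) (omap LT B)"
proof -
  interpret LT: idempotent_monad CT LT lT
    using lift by (simp add: lifts_to_coalgs_def localization_iff_idempotent_monad)
  show LTf: "amap LT f \<in> hom CT (omap LT A) (omap LT B)" using LT.L_hom f by blast
  have "amap forget (amap LT f) = amap L (amap forget f)"
    using lift homD(1)[OF f] by (simp add: lifts_to_coalgs_def fctr_eq_def)
  then show "amap LT f = (omap LT A, amap L (amap forget f), omap LT B)"
    using LTf by (auto simp: hom_coalg_cat)
qed

text \<open>Each lift supplies a structure along the unit, so \<open>unit_struct_unique\<close>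
  identifies the values on objects and the units. Arrows then agree because their endpoints and
  underlying arrows do.\<close>

lemma lifts_unique:
  assumes T: "preserves_local_objs C l C l T"
    and lift: "lifts_to_coalgs C T \<epsilon> \<delta> L l LT lT" and lift': "lifts_to_coalgs C T \<epsilon> \<delta> L l LT' lT'"
  shows "fctr_eq CT LT LT' \<and> (\<forall>A \<in> Obj CT. lT A = lT' A)"
proof -
  have eq: "omap LT A = omap LT' A" "lT A = lT' A" if "coalg A" for A
    using lifts_unit[OF lift that] lifts_unit[OF lift' that] unit_struct_unique[OF T that]
    by metis+
  have "amap LT f = amap LT' f" if "f \<in> Arr CT" for f
    using lifts_amap(1)[OF lift arr_hom[OF that]] lifts_amap(1)[OF lift' arr_hom[OF that]]
      eq(1) CT.dom_obj[OF that] CT.cod_obj[OF that] by simp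
  then show ?thesis using eq by (simp add: fctr_eq_def)
qed

text \<open>The arrow underlying \<open>lT A\<close> is \<open>l (fst A)\<close>, and the forgetful
  functor preserves and reflects isomorphisms.\<close>

lemma local_obj_lift_iff:
  assumes lift: "lifts_to_coalgs C T \<epsilon> \<delta> L l LT lT" and A: "coalg A"
  shows "local_obj CT lT A \<longleftrightarrow> local_obj C l (fst A)"
proof -
  obtain c where "lT A = (A, l (fst A), (omap L (fst A), c))" "lT A \<in> hom CT A (omap LT A)"
    using lifts_unit[OF lift A] .
  then show ?thesis
    using is_iso_coalg_iff A coalgD(1)[OF A] by (fastforce simp: local_obj_def)
qed

lemma local_equiv_lift_iff:
  assumes lift: "lifts_to_coalgs C T \<epsilon> \<delta> L l LT lT" and f: "f \<in> Arr CT"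
  shows "local_equiv CT LT f \<longleftrightarrow> local_equiv C L (amap forget f)"
  using is_iso_coalg_iff[OF lifts_amap(2)[OF lift arr_hom[OF f]]]
    lifts_amap(1)[OF lift arr_hom[OF f]] f homD(1)[OF U.amap_hom[OF arr_hom[OF f]]]
  by (simp add: local_equiv_def)

end

text \<open>In (b) the structures come from one function \<open>s\<close> of the coalgebra, because
  the clause on morphisms relates the structures chosen at two coalgebras.\<close>

theorem theorem4p6:
  fixes C :: "('o, 'm) cat"
    and T L :: "('o, 'm, 'o, 'm) fctr"
    and \<epsilon> \<delta> l :: "'o \<Rightarrow> 'm"
  assumes "comonad C T \<epsilon> \<delta>"
    and "localization C L l"
  shows
    "(preserves_local_objs C l C l T \<longleftrightarrow>
       (\<exists>s. (\<forall>X a. coalgebra C T \<epsilon> \<delta> (X, a) \<longrightarrow>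
               coalgebra C T \<epsilon> \<delta> (omap L X, s (X, a)) \<and>
               coalg_hom C T (X, a) (omap L X, s (X, a)) (l X)) \<and>
            (\<forall>X a Y b g. coalgebra C T \<epsilon> \<delta> (X, a) \<and> coalgebra C T \<epsilon> \<delta> (Y, b) \<and>
               coalg_hom C T (X, a) (Y, b) g \<longrightarrow>
               coalg_hom C T (omap L X, s (X, a)) (omap L Y, s (Y, b)) (amap L g)))) \<and>
     (preserves_local_objs C l C l T \<longleftrightarrow>
       (\<exists>LT lT. lifts_to_coalgs C T \<epsilon> \<delta> L l LT lT)) \<and>
     (preserves_local_objs C l C l T \<longleftrightarrow>
       (\<exists>LT lT \<theta>. localization (coalg_cat C T \<epsilon> \<delta>) LT lT \<and>
          nat_iso (coalg_cat C T \<epsilon> \<delta>) C (L \<circ>\<^sub>F forget) (forget \<circ>\<^sub>F LT) \<theta>)) \<and>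
     (preserves_local_objs C l C l T \<longrightarrow>
       (\<forall>X a. coalgebra C T \<epsilon> \<delta> (X, a) \<longrightarrow>
          (\<exists>!c. coalgebra C T \<epsilon> \<delta> (omap L X, c) \<and>
                coalg_hom C T (X, a) (omap L X, c) (l X))) \<and>
       (\<forall>LT lT LT' lT'.
          lifts_to_coalgs C T \<epsilon> \<delta> L l LT lT \<and> lifts_to_coalgs C T \<epsilon> \<delta> L l LT' lT' \<longrightarrow>
          fctr_eq (coalg_cat C T \<epsilon> \<delta>) LT LT' \<and>
          (\<forall>A \<in> Obj (coalg_cat C T \<epsilon> \<delta>). lT A = lT' A)) \<and>
       (\<forall>LT lT. lifts_to_coalgs C T \<epsilon> \<delta> L l LT lT \<longrightarrow>
          preserves_local_objs (coalg_cat C T \<epsilon> \<delta>) lT C l forget \<and>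
          reflects_local_objs (coalg_cat C T \<epsilon> \<delta>) lT C l forget \<and>
          preserves_equivs (coalg_cat C T \<epsilon> \<delta>) LT C L forget \<and>
          reflects_equivs (coalg_cat C T \<epsilon> \<delta>) LT C L forget))"
proof -
  interpret comonad C T \<epsilon> \<delta> by fact
  interpret comonad_localization C T \<epsilon> \<delta> L l
    using assms counit.source.dom.category_axioms
    by (simp add: comonad_localization_def comonad_on_category_def localization_iff_idempotent_monad)
  let ?a = "preserves_local_objs C l C l T"
  let ?s = "\<lambda>s. (\<forall>X a. coalgebra C T \<epsilon> \<delta> (X, a) \<longrightarrow>
               coalgebra C T \<epsilon> \<delta> (omap L X, s (X, a)) \<and>
               coalg_hom C T (X, a) (omap L X, s (X, a)) (l X)) \<and>
            (\<forall>X a Y b g. coalgebra C T \<epsilon> \<delta> (X, a) \<and> coalgebra C T \<epsilon> \<delta> (Y, b) \<and>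
               coalg_hom C T (X, a) (Y, b) g \<longrightarrow>
               coalg_hom C T (omap L X, s (X, a)) (omap L Y, s (Y, b)) (amap L g))"
  let ?c = "\<exists>LT lT. lifts_to_coalgs C T \<epsilon> \<delta> L l LT lT"
  let ?d = "\<exists>LT lT \<theta>. localization CT LT lT \<and>
    nat_iso CT C (L \<circ>\<^sub>F forget) (forget \<circ>\<^sub>F LT) \<theta>"
  \<comment> \<open>Statement (b) is \<open>natural_struct\<close> with the pairs written
    out.\<close>
  have s: "?s s \<longleftrightarrow> natural_struct s" for s
    by (simp add: natural_struct_def unit_struct_def split_paired_All)
  \<comment> \<open>The equivalences are obtained from the cycle (a), (b), (c), (d), (a).\<close>
  have ab: "?a \<Longrightarrow> Ex ?s" unfolding s using natural_lift_struct by blast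
  have bc: "Ex ?s \<Longrightarrow> ?c" unfolding s using natural_struct_imp_lifts by blast
  have cd: "?c \<Longrightarrow> ?d" using lifts_imp_nat_iso unfolding lifts_to_coalgs_def by blast
  have da: "?d \<Longrightarrow> ?a" using nat_iso_imp_preserves_local_objs by blast
  have unique: "\<exists>!c. coalgebra C T \<epsilon> \<delta> (omap L X, c) \<and> coalg_hom C T (X, a) (omap L X, c) (l X)"
    if "?a" "coalg (X, a)" for X a
    using unit_struct_exists[OF that] unit_struct_unique[OF that]
    unfolding unit_struct_def fst_conv by blast
  have U: "preserves_local_objs CT lT C l forget \<and> reflects_local_objs CT lT C l forget \<and>
      preserves_equivs CT LT C L forget \<and> reflects_equivs CT LT C L forget"
    if "lifts_to_coalgs C T \<epsilon> \<delta> L l LT lT" for LT lT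
    using local_obj_lift_iff[OF that] local_equiv_lift_iff[OF that]
    by (simp add: preserves_local_objs_def reflects_local_objs_def preserves_equivs_def
        reflects_equivs_def)
  have "?a \<longleftrightarrow> Ex ?s" "?a \<longleftrightarrow> ?c" "?a \<longleftrightarrow> ?d" using ab bc cd da by blast+
  then show ?thesis using unique lifts_unique U by (intro conjI impI allI) blast+
qed

end
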